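(* Let $N\ge 1$, let $V_1,\dots,V_N$ be views containing $n_1,\dots,n_N$ detections respectively, and let $\{P_{ij}\}_{i,j\in\{1,\dots,N\}}$ be a multi-view matching, where each $P_{ij}\in\{0,1\}^{n_i\times n_j}$ is a partial matching matrix. If $\{P_{ij}\}_{i,j}$ is partially cycle-consistent, then \[ P_{ii}=I_{n_i\times n_i}\quad\text{for all } i\in\{1,\dots,N\}, \] \[ P_{ij}P_{ji}=I_{iji}\quad\text{for all } i,j\in\{1,\dots,N\}, \] \[ P_{ij}P_{jk}P_{ki}=I_{ijki}\quad\text{for all } i,j,k\in\{1,\dots,N\}, \] where $I_{iji}\subseteq I_{n_i\times n_i}$ and $I_{ijki}\subseteq I_{n_i\times n_i}$ are the $n_i\times n_i$ binary matrices defined by \[ I_{iji}[a,c]=\begin{cases}1 & \text{if } a=c \text{ and there exists } b\in\{1,\dots,n_j\} \text{ with } P_{ij}[a,b]=1,\\ 0 & \text{otherwise,}\end{cases} \] \[ I_{ijki}[a,d]=\begin{cases}1 & \text{if } a=d \text{ and there exist } b\in\{1,\dots,n_j\},\ c\in\{1,\dots,n_k\} \text{ with } P_{ij}[a,b]=P_{jk}[b,c]=P_{ki}[c,d]=1,\\ 0 & \text{otherwise.}\end{cases} \]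
   Context: $X[a,b]$ denotes the $(a,b)$ entry of a matrix $X$, and $I_{n\times n}$ is the $n\times n$ identity matrix. Matrix products are ordinary products over the integers. For two binary matrices $X,Y$ of the same size, $X\subseteq Y$ means that $X[a,b]\le Y[a,b]$ for all $a,b$ (every match in $X$ is also a match in $Y$). A partial matching matrix $P\in\{0,1\}^{n\times m}$ is a binary matrix in which every row and every column contains at most one entry equal to $1$. The entry $P_{ij}[a,b]=1$ means that detection $a$ of view $V_i$ is matched to detection $b$ of view $V_j$. A multi-view matching is a family $\{P_{ij}\}_{i,j\in\{1,\dots,N\}}$ of such matrices, one for each ordered pair of views. A multi-view matching $\{P_{ij}\}_{i,j}$ is called partially cycle-consistent if (1) $P_{ii}=I_{n_i\times n_i}$ for all $i$; (2) $P_{ij}=P_{ji}^{T}$ for all $i,j$; (3) $P_{ij}P_{jk}\subseteq P_{ik}$ for all $i,j,k$ (matching from $V_i$ to $V_j$ and then to $V_k$ is a subset of the direct matching from $V_i$ to $V_k$). *)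

theory Defs
  imports "Jordan_Normal_Form.Matrix"
begin

text \<open>
  Matrices have type \<open>int mat\<close>, so that \<open>*\<close> is the ordinary matrix product over the integers.
  Views are numbered \<open>1, \<dots>, N\<close>; view \<open>i\<close> has \<open>n i\<close> detections, which are numbered from \<open>0\<close>
  in accordance with matrix indices. The relation \<open>X \<subseteq> Y\<close> on binary matrices is the
  entrywise order \<open>X \<le> Y\<close> on matrices, which also requires equal dimensions.
\<close>

definition partial_matching_mat :: "nat \<Rightarrow> nat \<Rightarrow> int mat \<Rightarrow> bool" where
  "partial_matching_mat r c X \<longleftrightarrow>
     X \<in> carrier_mat r c \<and> elements_mat X \<subseteq> {0, 1} \<and>
     (\<forall>a<r. \<exists>\<^sub>\<le>\<^sub>1 b. b < c \<and> X $$ (a, b) = 1) \<and>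
     (\<forall>b<c. \<exists>\<^sub>\<le>\<^sub>1 a. a < r \<and> X $$ (a, b) = 1)"

definition multi_view_matching :: "nat \<Rightarrow> (nat \<Rightarrow> nat) \<Rightarrow> (nat \<Rightarrow> nat \<Rightarrow> int mat) \<Rightarrow> bool" where
  "multi_view_matching N n P \<longleftrightarrow>
     (\<forall>i\<in>{1..N}. \<forall>j\<in>{1..N}. partial_matching_mat (n i) (n j) (P i j))"

definition partially_cycle_consistent ::
  "nat \<Rightarrow> (nat \<Rightarrow> nat) \<Rightarrow> (nat \<Rightarrow> nat \<Rightarrow> int mat) \<Rightarrow> bool" where
  "partially_cycle_consistent N n P \<longleftrightarrow>
     (\<forall>i\<in>{1..N}. P i i = 1\<^sub>m (n i)) \<and>
     (\<forall>i\<in>{1..N}. \<forall>j\<in>{1..N}. P i j = transpose_mat (P j i)) \<and>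
     (\<forall>i\<in>{1..N}. \<forall>j\<in>{1..N}. \<forall>k\<in>{1..N}. P i j * P j k \<le> P i k)"

definition partial_id2 ::
  "(nat \<Rightarrow> nat) \<Rightarrow> (nat \<Rightarrow> nat \<Rightarrow> int mat) \<Rightarrow> nat \<Rightarrow> nat \<Rightarrow> int mat" where
  "partial_id2 n P i j = mat (n i) (n i) (\<lambda>(a, c).
     if a = c \<and> (\<exists>b<n j. P i j $$ (a, b) = 1) then 1 else 0)"

definition partial_id3 ::
  "(nat \<Rightarrow> nat) \<Rightarrow> (nat \<Rightarrow> nat \<Rightarrow> int mat) \<Rightarrow> nat \<Rightarrow> nat \<Rightarrow> nat \<Rightarrow> int mat" where
  "partial_id3 n P i j k = mat (n i) (n i) (\<lambda>(a, d).
     if a = d \<and> (\<exists>b<n j. \<exists>c<n k.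
          P i j $$ (a, b) = 1 \<and> P j k $$ (b, c) = 1 \<and> P k i $$ (c, d) = 1)
     then 1 else 0)"

end

theory Submission
  imports Defs
begin

text \<open>
  The product of a partial matching matrix with a binary matrix is relational composition, since
  at most one summand of each entry is nonzero. Hence a nonzero entry \<open>(a, d)\<close> of
  \<open>P\<^sub>i\<^sub>j P\<^sub>j\<^sub>k P\<^sub>k\<^sub>i\<close> comes from matches \<open>a - b - c - d\<close>; condition (3) contracts \<open>a - b - c\<close> to a match
  \<open>a - c\<close> in \<open>P\<^sub>i\<^sub>k\<close>, so \<open>c\<close> is matched by \<open>P\<^sub>k\<^sub>i\<close> to both \<open>a\<close> and \<open>d\<close>, whence \<open>a = d\<close>.
\<close>

text \<open>Writing the entries through \<open>of_bool\<close> lets integer products of entries be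
  read as conjunctions of matches.\<close>

lemma partial_matching_mat_entry:
  assumes "partial_matching_mat r c X" "a < r" "b < c"
  shows "X $$ (a, b) = of_bool (X $$ (a, b) = 1)"
proof -
  have "X $$ (a, b) \<in> elements_mat X"
    using assms unfolding partial_matching_mat_def by (intro elements_matI) auto
  then show ?thesis
    using assms unfolding partial_matching_mat_def by auto
qed

lemma partial_matching_mat_row_unique:
  assumes "partial_matching_mat r c X" "a < r" "b < c" "b' < c"
    and "X $$ (a, b) = 1" "X $$ (a, b') = 1"
  shows "b = b'"
  using assms unfolding partial_matching_mat_def Uniq_def by blast

text \<open>Only the left factor has to be a partial matching: a single row of \<open>A\<close> then
  selects at most one index \<open>b\<close>. The right factor enters only through its column
  \<open>d\<close>, described by a predicate \<open>Q\<close>, so that \<open>X\<close> may itself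
  be a product of matchings.\<close>

lemma partial_matching_mat_mult_entry:
  assumes A: "partial_matching_mat r c A" and X: "X \<in> carrier_mat c s"
    and binary: "\<And>b. b < c \<Longrightarrow> X $$ (b, d) = of_bool (Q b)"
    and "a < r" "d < s"
  shows "(A * X) $$ (a, d) = of_bool (\<exists>b<c. A $$ (a, b) = 1 \<and> Q b)"
proof -
  have A': "A \<in> carrier_mat r c"
    using A unfolding partial_matching_mat_def by simp
  have "(A * X) $$ (a, d) = (\<Sum>b<c. A $$ (a, b) * X $$ (b, d))"
    using A' X assms(4,5) by (auto simp: scalar_prod_def lessThan_atLeast0 intro!: sum.cong)
  also have "\<dots> = (\<Sum>b<c. of_bool (A $$ (a, b) = 1 \<and> Q b))"
  proof (rule sum.cong)
    fix b assume "b \<in> {..<c}"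
    then have "A $$ (a, b) = of_bool (A $$ (a, b) = 1)" "X $$ (b, d) = of_bool (Q b)"
      using partial_matching_mat_entry[OF A \<open>a < r\<close>] binary by auto
    then show "A $$ (a, b) * X $$ (b, d) = of_bool (A $$ (a, b) = 1 \<and> Q b)"
      by (metis of_bool_conj)
  qed simp
  also have "\<dots> = of_bool (\<exists>b<c. A $$ (a, b) = 1 \<and> Q b)"
  proof (cases "\<exists>b<c. A $$ (a, b) = 1 \<and> Q b")
    case True
    then obtain b where b: "b < c" "A $$ (a, b) = 1" "Q b"
      by blast
    \<comment> \<open>Row \<open>a\<close> of \<open>A\<close> has its only 1 in column
      \<open>b\<close>, so every other summand vanishes, whatever \<open>Q\<close> says
      there.\<close>
    have "(\<Sum>b'<c. of_bool (A $$ (a, b') = 1 \<and> Q b')) = (\<Sum>b'<c. if b' = b then 1 else (0::int))"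
      using b partial_matching_mat_row_unique[OF A \<open>a < r\<close>] by (intro sum.cong) auto
    then show ?thesis
      using True b by simp
  next
    case False
    then show ?thesis
      by (auto intro!: sum.neutral)
  qed
  finally show ?thesis .
qed

theorem proposition1:
  fixes N :: nat and n :: "nat \<Rightarrow> nat" and P :: "nat \<Rightarrow> nat \<Rightarrow> int mat"
  assumes "N \<ge> 1"
    and "multi_view_matching N n P"
    and "partially_cycle_consistent N n P"
  shows "(\<forall>i\<in>{1..N}. P i i = 1\<^sub>m (n i)) \<and>
    (\<forall>i\<in>{1..N}. \<forall>j\<in>{1..N}.
       P i j * P j i = partial_id2 n P i j \<and> partial_id2 n P i j \<le> 1\<^sub>m (n i)) \<and>
    (\<forall>i\<in>{1..N}. \<forall>j\<in>{1..N}. \<forall>k\<in>{1..N}.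
       P i j * P j k * P k i = partial_id3 n P i j k \<and> partial_id3 n P i j k \<le> 1\<^sub>m (n i))"
proof -
  have pm: "partial_matching_mat (n i) (n j) (P i j)" if "i \<in> {1..N}" "j \<in> {1..N}" for i j
    using assms(2) that unfolding multi_view_matching_def by blast
  have carrier: "P i j \<in> carrier_mat (n i) (n j)" if "i \<in> {1..N}" "j \<in> {1..N}" for i j
    using pm[OF that] unfolding partial_matching_mat_def by blast
  have id: "P i i = 1\<^sub>m (n i)" if "i \<in> {1..N}" for i
    using assms(3) that unfolding partially_cycle_consistent_def by blast
  have sym: "P j i $$ (b, a) = P i j $$ (a, b)"
    if "i \<in> {1..N}" "j \<in> {1..N}" "a < n i" "b < n j" for i j a b
  proof -
    have "P j i = transpose_mat (P i j)"
      using assms(3) that unfolding partially_cycle_consistent_def by blast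
    then show ?thesis
      using carrier[of i j] that by simp
  qed
  have product: "(P i j * P j k) $$ (a, c) =
      of_bool (\<exists>b<n j. P i j $$ (a, b) = 1 \<and> P j k $$ (b, c) = 1)"
    if "i \<in> {1..N}" "j \<in> {1..N}" "k \<in> {1..N}" "a < n i" "c < n k" for i j k a c
    by (rule partial_matching_mat_mult_entry[OF pm carrier partial_matching_mat_entry[OF pm]])
      (simp_all only: that)
  have trans: "P i k $$ (a, c) = 1"
    if "i \<in> {1..N}" "j \<in> {1..N}" "k \<in> {1..N}" "a < n i" "b < n j" "c < n k"
      and "P i j $$ (a, b) = 1" "P j k $$ (b, c) = 1" for i j k a b c
  proof -
    have "P i j * P j k \<le> P i k"
      using assms(3) that(1-3) unfolding partially_cycle_consistent_def by blast
    then have "(P i j * P j k) $$ (a, c) \<le> P i k $$ (a, c)"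
      using carrier[of i k] that unfolding less_eq_mat_def by auto
    moreover have "(P i j * P j k) $$ (a, c) = 1"
      using product[of i j k a c] that by auto
    \<comment> \<open>The inclusion only bounds this entry below by 1; being binary, it must equal
      1.\<close>
    moreover have "P i k $$ (a, c) = of_bool (P i k $$ (a, c) = 1)"
      using partial_matching_mat_entry[OF pm] that by blast
    ultimately show ?thesis
      by (cases "P i k $$ (a, c) = 1") auto
  qed
  \<comment> \<open>By symmetry, row \<open>b\<close> of \<open>P j i\<close> has a 1 in column
    \<open>a\<close> as well as in column \<open>d\<close>.\<close>
  have closed: "a = d"
    if "i \<in> {1..N}" "j \<in> {1..N}" "a < n i" "b < n j" "d < n i"
      and "P i j $$ (a, b) = 1" "P j i $$ (b, d) = 1" for i j a b d
    using partial_matching_mat_row_unique[OF pm[of j i], of b a d] sym[of i j a b] that by simp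
  have two: "P i j * P j i = partial_id2 n P i j" if "i \<in> {1..N}" "j \<in> {1..N}" for i j
  proof (rule eq_matI)
    fix a c assume "a < dim_row (partial_id2 n P i j)" "c < dim_col (partial_id2 n P i j)"
    then have "a < n i" "c < n i"
      by (auto simp: partial_id2_def)
    \<comment> \<open>From left to right this is \<open>closed\<close>; conversely,
      \<open>sym\<close> supplies the return match from \<open>b\<close> to
      \<open>a\<close>.\<close>
    moreover have "(\<exists>b<n j. P i j $$ (a, b) = 1 \<and> P j i $$ (b, c) = 1) \<longleftrightarrow>
        a = c \<and> (\<exists>b<n j. P i j $$ (a, b) = 1)"
      using closed[OF that] sym[OF that] \<open>a < n i\<close> \<open>c < n i\<close> by metis
    ultimately show "(P i j * P j i) $$ (a, c) = partial_id2 n P i j $$ (a, c)"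
      using product[of i j i a c] that by (auto simp: partial_id2_def)
  qed (use carrier[of i j] carrier[of j i] that in \<open>auto simp: partial_id2_def\<close>)
  have three: "P i j * P j k * P k i = partial_id3 n P i j k"
    if "i \<in> {1..N}" "j \<in> {1..N}" "k \<in> {1..N}" for i j k
  proof (rule eq_matI)
    fix a d assume "a < dim_row (partial_id3 n P i j k)" "d < dim_col (partial_id3 n P i j k)"
    then have ad: "a < n i" "d < n i"
      by (auto simp: partial_id3_def)
    \<comment> \<open>Bracketing to the right keeps a partial matching matrix as the left factor,
      while \<open>product\<close> describes the entries of the right factor
      \<open>P j k * P k i\<close>.\<close>
    have "(P i j * P j k * P k i) $$ (a, d) = (P i j * (P j k * P k i)) $$ (a, d)"
      using carrier that by (metis assoc_mult_mat)
    also have "\<dots> = of_bool (\<exists>b<n j. P i j $$ (a, b) = 1 \<and>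
        (\<exists>c<n k. P j k $$ (b, c) = 1 \<and> P k i $$ (c, d) = 1))"
      by (rule partial_matching_mat_mult_entry[OF pm mult_carrier_mat[OF carrier carrier] product])
        (simp_all only: that ad)
    also have "\<dots> = partial_id3 n P i j k $$ (a, d)"
    proof -
      \<comment> \<open>\<open>trans\<close> shortens the cycle through \<open>j\<close> and
        \<open>k\<close> to one through \<open>k\<close> alone, to which \<open>closed\<close>
        applies with \<open>k\<close> as the intermediate view.\<close>
      have "a = d" if "b < n j" "c < n k" "P i j $$ (a, b) = 1" "P j k $$ (b, c) = 1"
        "P k i $$ (c, d) = 1" for b c
        using trans[of i j k a b c] closed[of i k a c d] that ad
          \<open>i \<in> {1..N}\<close> \<open>j \<in> {1..N}\<close> \<open>k \<in> {1..N}\<close> by blast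
      then have "(\<exists>b<n j. P i j $$ (a, b) = 1 \<and>
          (\<exists>c<n k. P j k $$ (b, c) = 1 \<and> P k i $$ (c, d) = 1)) \<longleftrightarrow>
          a = d \<and> (\<exists>b<n j. \<exists>c<n k.
            P i j $$ (a, b) = 1 \<and> P j k $$ (b, c) = 1 \<and> P k i $$ (c, d) = 1)"
        by blast
      then show ?thesis
        using ad by (auto simp: partial_id3_def)
    qed
    finally show "(P i j * P j k * P k i) $$ (a, d) = partial_id3 n P i j k $$ (a, d)" .
  qed (use carrier[of i j] carrier[of k i] that in \<open>auto simp: partial_id3_def\<close>)
  have "partial_id2 n P i j \<le> 1\<^sub>m (n i)" "partial_id3 n P i j k \<le> 1\<^sub>m (n i)" for i j k
    by (auto simp: partial_id2_def partial_id3_def less_eq_mat_def)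
  then show ?thesis
    using id two three by simp
qed

end
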